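(* Let $N=2$, $K=2$, let $\alpha,p_1,p_2,\beta\in(0,1)$, $\beta_1=\beta_2=\beta$, and let $a_1,a_2\ge 0$ with $a_1+a_2=1$. Let $J$ and $J^*$ be the particle flow rates in the system $S$ with these parameters and in the associated one-type system $S^*$, respectively. Then $J=J^*$.
   Context: System $S$ (synchronous exclusion process with two particle types on an open lattice of two cells). The cells are $1$ and $2$, each containing at most one particle, and each particle is of type $1$ or $2$. A state is $(x_1,x_2)\in\{0,1,2\}^2$, where $x_i=0$ means cell $i$ is vacant and $x_i=k>0$ means cell $i$ contains a particle of type $k$. Time is discrete. Given the state at time $t$, all of the following random events are mutually independent, occur simultaneously, depend only on the configuration at time $t$, and determine the state at time $t+1$ (a finite Markov chain): (i) if cell $1$ is vacant at time $t$, then with probability $\alpha$ a particle arrives from outside and is in cell $1$ at time $t+1$; it is of type $k$ with probability $a_k$; (ii) if at time $t$ cell $1$ contains a particle of type $k$ and cell $2$ is vacant, then with probability $p_k$ this particle is in cell $2$ at time $t+1$ (and cell $1$ is then vacant), otherwise it stays; (iii) if at time $t$ cell $2$ contains a particle of type $k$, then with probability $\beta_k$ it leaves the system and cell $2$ is vacant at time $t+1$, otherwise it stays. A particle in cell $1$ stays there if cell $2$ is occupied at time $t$. System $S^*$: the same process with the same $N=2$ and $\alpha$, but with a single type of particles, whose movement probability (from cell $1$ to a vacant cell $2$) is $p^*=\left(\frac{a_1}{p_1}+\frac{a_2}{p_2}\right)^{-1}$ and whose exit probability from cell $2$ is $\beta^*=\left(\frac{a_1}{\beta_1}+\frac{a_2}{\beta_2}\right)^{-1}$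 (which equals $\beta$ when $\beta_1=\beta_2=\beta$). Its states are $(x_1^*,x_2^* )\in\{0,1\}^2$ with $x_i^*=0$ if cell $i$ is vacant and $x_i^*=1$ if it is occupied. The stationary probability of a state is the limit of the probability that the system is in this state as $t\to\infty$ (it exists and is independent of the initial state; equivalently, it is given by the unique stationary distribution of the Markov chain). The particle flow rate $J$ (resp. $J^*$) is the stationary probability that, in a given time step, a particle enters the system $S$ (resp. $S^*$) from outside, i.e. the probability of the event that an arrival occurs in one step when the current state is distributed according to the stationary distribution. *)

theory Defs
  imports "HOL-Probability.Probability"
begin

text \<open>Law at time \<open>t\<close> of the Markov chain with transition kernel \<open>K\<close> started in \<open>s0\<close>.\<close>

primrec law_at :: "('s \<Rightarrow> 's pmf) \<Rightarrow> 's \<Rightarrow> nat \<Rightarrow> 's pmf" where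
  "law_at K s0 0 = return_pmf s0"
| "law_at K s0 (Suc t) = bind_pmf (law_at K s0 t) K"

text \<open>The same \<open>q\<close> has to be the limit from every initial state.\<close>

definition stationary_prob :: "('s \<Rightarrow> 's pmf) \<Rightarrow> 's \<Rightarrow> real" where
  "stationary_prob K s = (THE q. \<forall>s0. (\<lambda>t. pmf (law_at K s0 t) s) \<longlonglongrightarrow> q)"

text \<open>
  A state lists the contents of cell 1 and cell 2, with \<open>None\<close> for a vacant cell; \<open>'k\<close> is the
  set of particle types.
\<close>

type_synonym 'k state = "'k option \<times> 'k option"

primrec cell_event :: "('k \<Rightarrow> real) \<Rightarrow> 'k option \<Rightarrow> bool pmf" where
  "cell_event f None = return_pmf False"
| "cell_event f (Some k) = bernoulli_pmf (f k)"

text \<open>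
  One time step: the draws are independent, and every rule refers to the configuration
  \<open>(x1, x2)\<close> at the beginning of the step. The Boolean component of the result records whether
  a particle entered from outside. The weights \<open>a\<close> have to be nonnegative with sum 1 for
  \<^term>\<open>embed_pmf a\<close> to be the distribution with probabilities \<open>a\<close>, and the remaining
  parameters have to lie in \<open>[0, 1]\<close>, to which \<^const>\<open>bernoulli_pmf\<close> truncates its argument.
\<close>

definition step ::
  "real \<Rightarrow> ('k \<Rightarrow> real) \<Rightarrow> ('k \<Rightarrow> real) \<Rightarrow> ('k \<Rightarrow> real) \<Rightarrow> 'k state \<Rightarrow> (bool \<times> 'k state) pmf" where
  "step \<alpha> a p \<beta> = (\<lambda>(x1, x2). do {
     arrival \<leftarrow> bernoulli_pmf \<alpha>;
     k \<leftarrow> embed_pmf a;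
     move \<leftarrow> cell_event p x1;
     exit \<leftarrow> cell_event \<beta> x2;
     let enters = (x1 = None \<and> arrival);
     let moves = (x2 = None \<and> move);
     return_pmf (enters,
       (if enters then Some k else if moves then None else x1),
       (if moves then x1 else if exit then None else x2))
   })"

definition trans_pmf ::
  "real \<Rightarrow> ('k \<Rightarrow> real) \<Rightarrow> ('k \<Rightarrow> real) \<Rightarrow> ('k \<Rightarrow> real) \<Rightarrow> 'k state \<Rightarrow> 'k state pmf" where
  "trans_pmf \<alpha> a p \<beta> s = map_pmf snd (step \<alpha> a p \<beta> s)"

definition flow_rate ::
  "real \<Rightarrow> ('k::finite \<Rightarrow> real) \<Rightarrow> ('k \<Rightarrow> real) \<Rightarrow> ('k \<Rightarrow> real) \<Rightarrow> real" where
  "flow_rate \<alpha> a p \<beta> =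
     (\<Sum>s\<in>UNIV. stationary_prob (trans_pmf \<alpha> a p \<beta>) s *
                measure_pmf.prob (step \<alpha> a p \<beta> s) {(enters, s'). enters})"

definition eff_prob :: "('k::finite \<Rightarrow> real) \<Rightarrow> ('k \<Rightarrow> real) \<Rightarrow> real" where
  "eff_prob a f = inverse (\<Sum>k\<in>UNIV. a k / f k)"

text \<open>The associated one-type system is the same process with particle type \<^typ>\<open>unit\<close>.\<close>

definition flow_rate_star ::
  "real \<Rightarrow> ('k::finite \<Rightarrow> real) \<Rightarrow> ('k \<Rightarrow> real) \<Rightarrow> ('k \<Rightarrow> real) \<Rightarrow> real" where
  "flow_rate_star \<alpha> a p \<beta> =
     flow_rate \<alpha> (\<lambda>_::unit. 1) (\<lambda>_. eff_prob a p) (\<lambda>_. eff_prob a \<beta>)"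

datatype ptype = Type1 | Type2

lemma UNIV_ptype: "UNIV = {Type1, Type2}"
  using ptype.exhaust by auto

instance ptype :: finite
  by standard (simp add: UNIV_ptype)

end

theory Submission imports Defs begin

text \<open>
  From every state the empty state can be reached in exactly three steps, so by a Doeblin
  contraction the chain converges to a stationary law. Let \<open>J\<close> be the flow rate. As the exit
  probability does not depend on the type, the balance equations show that the stationary
  probability of \<open>(k, 0)\<close> is \<open>a k / p k * J\<close> whereas the probabilities that cell 1 is vacant and that both
  cells are occupied are multiples of \<open>J\<close> with factors depending on \<open>\<alpha>\<close> and \<open>\<beta>\<close> only.
  Normalisation then expresses \<open>J\<close> through \<open>\<alpha>\<close>, \<open>\<beta>\<close> and the mean \<open>\<Sum>k. a k / p k\<close>, which the
  one-type system shares.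
\<close>

section \<open>Convergence to a stationary law on a finite state space\<close>

text \<open>Chapman-Kolmogorov. The recursion of \<open>law_at\<close> appends a last step; the
  contraction argument has to condition on the first \<open>m\<close> steps instead.\<close>

lemma law_at_add:
  "law_at K s (m + n) = bind_pmf (law_at K s m) (\<lambda>s'. law_at K s' n)"
  by (induction n) (simp_all add: bind_return_pmf' bind_assoc_pmf)

lemma pmf_bind_finite:
  fixes M :: "'s::finite pmf"
  shows "pmf (bind_pmf M K) z = (\<Sum>s\<in>UNIV. pmf M s * pmf (K s) z)"
  unfolding pmf_bind by (subst integral_measure_pmf_real[of UNIV]) (simp_all add: mult.commute)

lemma sum_pmf_UNIV: "(\<Sum>s\<in>UNIV. pmf M s) = 1" for M :: "'s::finite pmf"
  by (rule sum_pmf_eq_1) auto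

text \<open>
  A guaranteed weight \<open>\<epsilon>\<close> at a common point \<open>c\<close> makes the averaging operator contract the
  oscillation of \<open>f\<close> by the factor \<open>1 - \<epsilon>\<close>.
\<close>

lemma pmf_average_le:
  fixes M :: "'s::finite pmf"
  assumes "\<And>s. f s \<le> B" "0 \<le> \<epsilon>" "\<epsilon> \<le> pmf M c"
  shows "(\<Sum>s\<in>UNIV. pmf M s * f s) \<le> \<epsilon> * f c + (1 - \<epsilon>) * B"
proof -
  have "\<epsilon> * (B - f c) \<le> pmf M c * (B - f c)"
    using assms by (intro mult_right_mono) (auto simp: diff_ge_0_iff_ge)
  also have "\<dots> \<le> (\<Sum>s\<in>UNIV. pmf M s * (B - f s))"
    by (rule member_le_sum) (use assms(1) in \<open>auto simp: diff_ge_0_iff_ge\<close>)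
  also have "\<dots> = B - (\<Sum>s\<in>UNIV. pmf M s * f s)"
    by (simp add: right_diff_distrib sum_subtractf sum_distrib_right[symmetric] sum_pmf_UNIV)
  finally show ?thesis by (simp add: algebra_simps)
qed

lemma pmf_average_ge:
  fixes M :: "'s::finite pmf"
  assumes "\<And>s. B \<le> f s" "0 \<le> \<epsilon>" "\<epsilon> \<le> pmf M c"
  shows "\<epsilon> * f c + (1 - \<epsilon>) * B \<le> (\<Sum>s\<in>UNIV. pmf M s * f s)"
  using pmf_average_le[of "\<lambda>s. - f s" "- B" \<epsilon> M c] assms by (simp add: sum_negf algebra_simps)

text \<open>The maximum and the minimum over the initial states of the probability of
  \<open>z\<close> are monotone in time, and every \<open>n\<close> steps their distance shrinks by
  a fixed factor, so they meet in one limit.\<close>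

lemma law_at_convergent:
  fixes K :: "'s::finite \<Rightarrow> 's pmf"
  assumes "\<And>s. 0 < pmf (law_at K s n) c"
  obtains q where "\<And>s. (\<lambda>t. pmf (law_at K s t) z) \<longlonglongrightarrow> q"
proof -
  define P where "P t s = pmf (law_at K s t) z" for t s
  define U where "U t = Max (range (P t))" for t
  define L where "L t = Min (range (P t))" for t
  have P_le: "P t s \<le> U t" and P_ge: "L t \<le> P t s" for t s
    by (simp_all add: U_def L_def)
  have U_least: "U t \<le> B" if "\<And>s. P t s \<le> B" for t B
    using that by (auto simp: U_def)
  have L_greatest: "B \<le> L t" if "\<And>s. B \<le> P t s" for t B
    using that by (auto simp: L_def)
  have P_add: "P (m + t) s = (\<Sum>s'\<in>UNIV. pmf (law_at K s m) s' * P t s')" for m t s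
    by (simp add: P_def law_at_add pmf_bind_finite)
  \<comment> \<open>A minimum over finitely many initial states, hence a positive weight at
    \<open>c\<close> uniform in \<open>s\<close>.\<close>
  define \<epsilon> where "\<epsilon> = Min (range (\<lambda>s. pmf (law_at K s n) c))"
  have \<epsilon>: "0 < \<epsilon>" "\<And>s. \<epsilon> \<le> pmf (law_at K s n) c"
    using assms by (auto simp: \<epsilon>_def)
  have U_bound: "U (n + t) \<le> \<epsilon> * P t c + (1 - \<epsilon>) * U t" for t
    using \<epsilon> P_le by (intro U_least) (auto simp: P_add intro!: pmf_average_le)
  have L_bound: "\<epsilon> * P t c + (1 - \<epsilon>) * L t \<le> L (n + t)" for t
    using \<epsilon> P_ge by (intro L_greatest) (auto simp: P_add intro!: pmf_average_ge)
  \<comment> \<open>The common term \<open>\<epsilon> * P t c\<close> cancels.\<close>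
  have contract: "U (n + t) - L (n + t) \<le> (1 - \<epsilon>) * (U t - L t)" for t
    using U_bound[of t] L_bound[of t] by (simp add: algebra_simps)
  \<comment> \<open>Weight 0 in the averaging bound: a plain average cannot exceed the
    maximum.\<close>
  have "U (Suc t) \<le> U t" for t
    using pmf_average_le[of "P t" "U t" 0, OF P_le]
    by (intro U_least) (simp add: P_add[of 1, simplified])
  then have U_dec: "decseq U" by (rule decseq_SucI)
  have "L t \<le> L (Suc t)" for t
    using pmf_average_ge[of "L t" "P t" 0, OF P_ge]
    by (intro L_greatest) (simp add: P_add[of 1, simplified])
  then have L_inc: "incseq L" by (rule incseq_SucI)
  have "\<forall>t. 0 \<le> U t"
    using order_trans[OF pmf_nonneg P_le[of _ c, unfolded P_def]] by blast
  then obtain u where u: "U \<longlonglongrightarrow> u" using decseq_convergent[OF U_dec, of 0] by blast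
  have "\<forall>t. L t \<le> 1"
    using order_trans[OF P_ge[of _ c, unfolded P_def] pmf_le_1] by blast
  then obtain l where l: "L \<longlonglongrightarrow> l" using incseq_convergent[OF L_inc, of 1] by blast
  have "(\<lambda>t. U (n + t) - L (n + t)) \<longlonglongrightarrow> u - l"
    using tendsto_diff[OF u l] LIMSEQ_ignore_initial_segment[of "\<lambda>t. U t - L t" "u - l" n]
    by (simp add: add.commute)
  moreover have "(\<lambda>t. (1 - \<epsilon>) * (U t - L t)) \<longlonglongrightarrow> (1 - \<epsilon>) * (u - l)"
    by (intro tendsto_intros u l)
  ultimately have "u - l \<le> (1 - \<epsilon>) * (u - l)"
    by (rule LIMSEQ_le) (use contract in blast)
  then have "\<epsilon> * (u - l) \<le> 0" by (simp add: algebra_simps)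
  then have "u \<le> l" using \<epsilon>(1) by (simp add: mult_le_0_iff)
  moreover have "l \<le> u"
    by (rule LIMSEQ_le[OF l u]) (use order_trans[OF P_ge[of _ c] P_le[of _ c]] in blast)
  ultimately have "u = l" by simp
  then have "(\<lambda>t. P t s) \<longlonglongrightarrow> u" for s
    by (intro tendsto_sandwich[OF _ _ l[unfolded \<open>u = l\<close>[symmetric]] u] always_eventually allI P_ge P_le)
  then show thesis unfolding P_def by (rule that)
qed

text \<open>Convergence makes the \<open>THE\<close> in \<open>stationary_prob\<close> a genuine
  limit, and identities between finite sums pass to it. Balance is tested against a function
  \<open>f\<close>, so that an indicator yields the balance of a whole set of states.\<close>

lemma
  fixes K :: "'s::finite \<Rightarrow> 's pmf"
  assumes "\<And>s. 0 < pmf (law_at K s n) c"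
  shows sum_stationary_prob: "(\<Sum>s\<in>UNIV. stationary_prob K s) = 1"
    and stationary_prob_balance:
      "(\<Sum>s\<in>UNIV. stationary_prob K s * f s) =
       (\<Sum>s\<in>UNIV. stationary_prob K s * measure_pmf.expectation (K s) f)"
proof -
  have lim: "(\<lambda>t. pmf (law_at K s0 t) s) \<longlonglongrightarrow> stationary_prob K s" for s0 s
  proof -
    obtain q where q: "\<And>s0. (\<lambda>t. pmf (law_at K s0 t) s) \<longlonglongrightarrow> q"
      using law_at_convergent[OF assms] by blast
    then have "stationary_prob K s = q"
      unfolding stationary_prob_def by (intro the_equality) (auto intro: LIMSEQ_unique)
    with q show ?thesis by simp
  qed
  \<comment> \<open>The limit is the same from every initial state, so \<open>undefined\<close>
    serves as one.\<close>
  have "(\<lambda>t. \<Sum>s\<in>UNIV. pmf (law_at K undefined t) s) \<longlonglongrightarrow> (\<Sum>s\<in>UNIV. stationary_prob K s)"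
    by (intro tendsto_sum lim)
  then show "(\<Sum>s\<in>UNIV. stationary_prob K s) = 1"
    by (simp add: sum_pmf_UNIV LIMSEQ_const_iff)
  have balance: "stationary_prob K z = (\<Sum>s\<in>UNIV. stationary_prob K s * pmf (K s) z)" for z
  proof (rule LIMSEQ_unique[OF LIMSEQ_Suc[OF lim]])
    show "(\<lambda>t. pmf (law_at K undefined (Suc t)) z)
      \<longlonglongrightarrow> (\<Sum>s\<in>UNIV. stationary_prob K s * pmf (K s) z)"
      by (simp add: pmf_bind_finite) (intro tendsto_intros lim)
  qed
  have "(\<Sum>z\<in>UNIV. stationary_prob K z * f z) =
      (\<Sum>z\<in>UNIV. \<Sum>s\<in>UNIV. stationary_prob K s * pmf (K s) z * f z)"
    by (subst balance) (simp add: sum_distrib_right)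
  also have "\<dots> = (\<Sum>s\<in>UNIV. stationary_prob K s * (\<Sum>z\<in>UNIV. f z * pmf (K s) z))"
    by (subst sum.swap) (simp add: sum_distrib_left mult_ac)
  finally show "(\<Sum>s\<in>UNIV. stationary_prob K s * f s) =
       (\<Sum>s\<in>UNIV. stationary_prob K s * measure_pmf.expectation (K s) f)"
    by (simp add: integral_measure_pmf_real[of UNIV])
qed

section \<open>One step of the exclusion process\<close>

lemma sum_UNIV_state:
  "(\<Sum>s\<in>UNIV. f s) = f (None, None) + (\<Sum>j\<in>UNIV. f (None, Some j))
     + (\<Sum>k\<in>UNIV. f (Some k, None)) + (\<Sum>k\<in>UNIV. \<Sum>j\<in>UNIV. f (Some k, Some j))"
  for f :: "('k::finite) state \<Rightarrow> real"
proof -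
  have option: "(\<Sum>x\<in>UNIV. g x) = g None + (\<Sum>k\<in>UNIV. g (Some k))" for g :: "'k option \<Rightarrow> real"
    by (simp add: UNIV_option_conv sum.reindex)
  show ?thesis
    by (simp only: UNIV_Times_UNIV[symmetric] sum.cartesian_product' option sum.distrib
        add.assoc)
qed

lemma expectation_trans_pmf:
  "measure_pmf.expectation (trans_pmf \<alpha> a p \<beta> s) f =
    measure_pmf.expectation (step \<alpha> a p \<beta> s) (\<lambda>x. f (snd x))"
  for f :: "'k state \<Rightarrow> real"
  by (simp add: trans_pmf_def)

lemma expectation_bind_bernoulli_pmf:
  fixes f :: "'b::finite \<Rightarrow> real"
  assumes "0 \<le> q" "q \<le> 1"
  shows "measure_pmf.expectation (bernoulli_pmf q \<bind> F) f =
    q * measure_pmf.expectation (F True) f + (1 - q) * measure_pmf.expectation (F False) f"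
  using assms by (subst pmf_expectation_bind[of UNIV]) (auto simp: UNIV_bool)

context
  fixes \<alpha> \<beta> :: real and a p :: "'k::finite \<Rightarrow> real"
  assumes \<alpha>: "0 < \<alpha>" "\<alpha> < 1" and \<beta>: "0 < \<beta>" "\<beta> \<le> 1"
    and p: "\<And>k. 0 < p k" "\<And>k. p k \<le> 1"
    and a: "\<And>k. 0 \<le> a k" "(\<Sum>k\<in>UNIV. a k) = 1"
begin

lemma pmf_embed_weights: "pmf (embed_pmf a) k = a k"
proof (rule pmf_embed_pmf[OF a(1)])
  show "(\<integral>\<^sup>+ k. ennreal (a k) \<partial>count_space UNIV) = 1"
    using a by (simp add: nn_integral_count_space_finite sum_ennreal)
qed

lemma expectation_bind_embed_weights:
  fixes f :: "'b::finite \<Rightarrow> real"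
  shows "measure_pmf.expectation (embed_pmf a \<bind> F) f =
    (\<Sum>k\<in>UNIV. a k * measure_pmf.expectation (F k) f)"
  by (subst pmf_expectation_bind[of UNIV]) (auto simp: pmf_embed_weights)

text \<open>One formula per occupancy pattern; draws without effect in a pattern integrate out to
  1.\<close>

lemma expectation_step:
  fixes f :: "bool \<times> 'k state \<Rightarrow> real"
  shows "measure_pmf.expectation (step \<alpha> a p (\<lambda>_. \<beta>) (None, None)) f =
      \<alpha> * (\<Sum>k\<in>UNIV. a k * f (True, Some k, None)) + (1 - \<alpha>) * f (False, None, None)"
    and "measure_pmf.expectation (step \<alpha> a p (\<lambda>_. \<beta>) (None, Some j)) f =
      \<alpha> * (\<Sum>k\<in>UNIV. a k * (\<beta> * f (True, Some k, None) + (1 - \<beta>) * f (True, Some k, Some j)))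
      + (1 - \<alpha>) * (\<beta> * f (False, None, None) + (1 - \<beta>) * f (False, None, Some j))"
    and "measure_pmf.expectation (step \<alpha> a p (\<lambda>_. \<beta>) (Some k, None)) f =
      p k * f (False, None, Some k) + (1 - p k) * f (False, Some k, None)"
    and "measure_pmf.expectation (step \<alpha> a p (\<lambda>_. \<beta>) (Some k, Some j)) f =
      \<beta> * f (False, Some k, None) + (1 - \<beta>) * f (False, Some k, Some j)"
  using \<alpha> \<beta> p[of k] a(2)
  by (simp_all add: step_def bind_return_pmf expectation_bind_bernoulli_pmf
      expectation_bind_embed_weights sum_distrib_right[symmetric] flip: distrib_right)

lemma prob_enters:
  "measure_pmf.prob (step \<alpha> a p (\<lambda>_. \<beta>) s) {(enters, s'). enters} = of_bool (fst s = None) * \<alpha>"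
proof -
  have "measure_pmf.prob (step \<alpha> a p (\<lambda>_. \<beta>) s) {(enters, s'). enters} =
      measure_pmf.expectation (step \<alpha> a p (\<lambda>_. \<beta>) s) (indicator {(enters, s'). enters})"
    by simp
  also have "indicator {(enters, s'). enters} = (\<lambda>x. of_bool (fst x) :: real)"
    by (auto simp: indicator_def)
  also have "measure_pmf.expectation (step \<alpha> a p (\<lambda>_. \<beta>) s) \<dots> = of_bool (fst s = None) * \<alpha>"
    using a(2)
    by (cases s; cases "fst s"; cases "snd s")
       (simp_all add: expectation_step sum_distrib_right[symmetric])
  finally show ?thesis .
qed

text \<open>The longest route is \<open>(k, j)\<close>, \<open>(k, 0)\<close>,
  \<open>(0, k)\<close>, \<open>(0, 0)\<close>, writing 0 for a vacant cell. Shorter ones are padded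
  by waiting in the empty state, which is possible as \<open>\<alpha> < 1\<close>.\<close>

lemma pmf_law_at_3_empty: "0 < pmf (law_at (trans_pmf \<alpha> a p (\<lambda>_. \<beta>)) s 3) (None, None)"
proof -
  let ?K = "trans_pmf \<alpha> a p (\<lambda>_. \<beta>)"
  have pmf: "pmf (?K s) z = measure_pmf.expectation (?K s) (\<lambda>x. of_bool (x = z))" for s z
    by (subst integral_measure_pmf_real[of "{z}"]) auto
  have "(None, None) \<in> set_pmf (?K (None, x))" for x
    using \<alpha> \<beta> by (cases x) (auto simp: set_pmf_iff pmf expectation_trans_pmf expectation_step)
  moreover have "(None, Some k) \<in> set_pmf (?K (Some k, None))"
    "(Some k, None) \<in> set_pmf (?K (Some k, Some j))" for k j
    using p[of k] \<beta> by (auto simp: set_pmf_iff pmf expectation_trans_pmf expectation_step)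
  moreover obtain x y where "s = (x, y)" by fastforce
  ultimately have "(None, None) \<in> set_pmf (law_at ?K s 3)"
    by (cases x; cases y) (fastforce simp: numeral_3_eq_3 simp del: split_paired_Ex)+
  then show ?thesis by (simp add: pmf_positive_iff)
qed

section \<open>The flow rate from the balance equations\<close>

text \<open>Multiplied by the flow rate, the three summands are the probabilities that cell 1 is
  vacant, that only cell 1 is occupied, and that both cells are occupied. The particle type is
  arbitrary, so both systems are instances.\<close>

lemma flow_rate_eq:
  "flow_rate \<alpha> a p (\<lambda>_. \<beta>) =
     inverse (1 / \<alpha> + (\<Sum>k\<in>UNIV. a k / p k) + \<alpha> * (1 - \<beta>) / (\<beta> * (\<alpha> + \<beta> - \<alpha> * \<beta>)))"
proof -
  let ?K = "trans_pmf \<alpha> a p (\<lambda>_. \<beta>)"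
  define u where "u = stationary_prob ?K (None, None)"
  define V where "V = (\<Sum>j\<in>UNIV. stationary_prob ?K (None, Some j))"
  define w where "w k = stationary_prob ?K (Some k, None)" for k
  define R where "R k = (\<Sum>j\<in>UNIV. stationary_prob ?K (Some k, Some j))" for k
  define J where "J = \<alpha> * (u + V)"
  note defs = u_def V_def w_def R_def
  note balance = stationary_prob_balance[OF pmf_law_at_3_empty]
  note expand = sum_UNIV_state sum_distrib_right[symmetric] defs[symmetric]
  have total: "u + V + (\<Sum>k\<in>UNIV. w k) + (\<Sum>k\<in>UNIV. R k) = 1"
    using sum_stationary_prob[OF pmf_law_at_3_empty] by (simp add: sum_UNIV_state defs)
  have u: "u = (1 - \<alpha>) * u + (1 - \<alpha>) * \<beta> * V"
    using balance[of "\<lambda>s. of_bool (s = (None, None))"]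
    by (simp add: expectation_step expectation_trans_pmf expand) (simp add: mult_ac)
  have w: "w k = \<alpha> * a k * u + \<alpha> * \<beta> * a k * V + (1 - p k) * w k + \<beta> * R k" for k
    using balance[of "\<lambda>s. of_bool (s = (Some k, None))"]
    by (simp add: expectation_step expectation_trans_pmf expand)
       (simp add: of_bool_def if_distrib if_distribR algebra_simps cong: if_cong)
  \<comment> \<open>Summing over the type in cell 2 closes the equation because all types share the
    exit probability \<open>\<beta>\<close>.\<close>
  have R: "R k = \<alpha> * (1 - \<beta>) * a k * V + (1 - \<beta>) * R k" for k
    using balance[of "\<lambda>s. of_bool (fst s = Some k \<and> snd s \<noteq> None)"]
    by (simp add: expectation_step expectation_trans_pmf expand)
       (simp add: of_bool_def if_distrib if_distribR algebra_simps cong: if_cong)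
  have R': "\<beta> * R k = a k * (\<alpha> * (1 - \<beta>) * V)" for k
    using R[of k] by (simp add: algebra_simps)
  \<comment> \<open>Particles of type \<open>k\<close> move to cell 2 at the rate at which they
    arrive.\<close>
  have "p k * w k = a k * J" for k
    using w[of k] R'[of k] by (simp add: J_def algebra_simps)
  then have "w k = a k / p k * J" for k
    using p(1)[of k] by (simp add: field_simps)
  then have sum_w: "(\<Sum>k\<in>UNIV. w k) = (\<Sum>k\<in>UNIV. a k / p k) * J"
    by (simp add: sum_distrib_right)
  have sum_R: "\<beta> * (\<Sum>k\<in>UNIV. R k) = \<alpha> * (1 - \<beta>) * V"
    using a(2) by (simp add: sum_distrib_left R' flip: sum_distrib_right)
  have D: "0 < \<alpha> + \<beta> - \<alpha> * \<beta>"
    using \<alpha> \<beta> mult_strict_right_mono[of \<alpha> 1 \<beta>] by linarith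
  \<comment> \<open>Balance at the empty state reads
    \<open>\<alpha> * u = (1 - \<alpha>) * \<beta> * V\<close>, which eliminates
    \<open>u\<close>.\<close>
  have J: "J = (\<alpha> + \<beta> - \<alpha> * \<beta>) * V"
    using u by (simp add: J_def algebra_simps)
  have sum_R': "(\<Sum>k\<in>UNIV. R k) = \<alpha> * (1 - \<beta>) / (\<beta> * (\<alpha> + \<beta> - \<alpha> * \<beta>)) * J"
    using sum_R D \<beta>(1) unfolding J by (simp add: eq_divide_eq mult_ac)
  have uV: "u + V = 1 / \<alpha> * J"
    using \<alpha> by (simp add: J_def)
  have "flow_rate \<alpha> a p (\<lambda>_. \<beta>) = J"
    by (simp add: flow_rate_def prob_enters sum_UNIV_state J_def u_def V_def sum_distrib_left
        algebra_simps)
  moreover have "(1 / \<alpha> + (\<Sum>k\<in>UNIV. a k / p k) + \<alpha> * (1 - \<beta>) / (\<beta> * (\<alpha> + \<beta> - \<alpha> * \<beta>))) * J = 1"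
    using total unfolding uV sum_w sum_R' by (simp only: distrib_right)
  ultimately show ?thesis
    by (metis inverse_unique)
qed

end

theorem theorem5:
  fixes \<alpha> \<beta> :: real and a p :: "ptype \<Rightarrow> real"
  assumes "0 < \<alpha>" "\<alpha> < 1"
    and "0 < p Type1" "p Type1 < 1"
    and "0 < p Type2" "p Type2 < 1"
    and "0 < \<beta>" "\<beta> < 1"
    and "0 \<le> a Type1" "0 \<le> a Type2" "a Type1 + a Type2 = 1"
  shows "flow_rate \<alpha> a p (\<lambda>_. \<beta>) = flow_rate_star \<alpha> a p (\<lambda>_. \<beta>)"
proof -
  have p: "0 < p k" "p k \<le> 1" and a: "0 \<le> a k" for k
    using assms by (cases k; simp)+
  have sum_a: "(\<Sum>k\<in>UNIV. a k) = 1"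
    using assms by (simp add: UNIV_ptype)
  \<comment> \<open>This makes \<open>eff_prob a p\<close> a probability in (0, 1], as
    \<open>flow_rate_eq\<close> requires of a movement probability.\<close>
  have "(\<Sum>k\<in>UNIV. a k) \<le> (\<Sum>k\<in>UNIV. a k / p k)"
    using p a by (intro sum_mono) (simp add: le_divide_eq mult_left_le)
  then have P: "1 \<le> (\<Sum>k\<in>UNIV. a k / p k)"
    by (simp add: sum_a)
  have "eff_prob a (\<lambda>_. \<beta>) = \<beta>"
    by (simp add: eff_prob_def sum_a flip: sum_divide_distrib)
  then have "flow_rate_star \<alpha> a p (\<lambda>_. \<beta>) =
      flow_rate \<alpha> (\<lambda>_::unit. 1) (\<lambda>_. eff_prob a p) (\<lambda>_. \<beta>)"
    by (simp add: flow_rate_star_def)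
  \<comment> \<open>The reciprocal of the harmonic mean \<open>eff_prob a p\<close> is exactly the
    sum of \<open>a k / p k\<close>.\<close>
  also have "\<dots> = inverse (1 / \<alpha> + (\<Sum>k\<in>UNIV. a k / p k)
      + \<alpha> * (1 - \<beta>) / (\<beta> * (\<alpha> + \<beta> - \<alpha> * \<beta>)))"
    using assms P by (subst flow_rate_eq) (simp_all add: eff_prob_def inverse_le_1_iff divide_inverse)
  also have "\<dots> = flow_rate \<alpha> a p (\<lambda>_. \<beta>)"
    using assms p a sum_a by (subst flow_rate_eq) simp_all
  finally show ?thesis ..
qed

end
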